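(* If $\exists x\,A(x)$ is derivable in $LJ^+$, then for some variables $t_1,\dots,t_n$ ($n\ge 1$), the formula $A(t_1)\lor\dots\lor A(t_n)$ is derivable in $LJ^+$ as well.
   Context: Formulas are first-order formulas without function symbols and without object constants (so the only terms are variables), built from propositional symbols (relation symbols of arity $0$), predicate symbols (relation symbols of arity at least $1$), the logical constants $\top,\bot$, the connectives $\&,\lor,\neg,\supset$ and the quantifiers $\forall,\exists$; quantified formulas $\forall x\,F(x)$, $\exists x\,F(x)$ are formed only from $F(x)$ in which $x$ occurs free. $\top,\bot$ are not counted as propositional or predicate symbols. A formula is propositional if it contains only propositional symbols (no predicate symbols). A sequent is $\Gamma\vdash\Lambda$ with $\Gamma$ a finite, possibly empty sequence of formulas and $\Lambda$ either a single formula or empty. The calculus $LJ$ (Gentzen's intuitionistic sequent calculus) has axioms $A\vdash A$ (any formula $A$), $\vdash\top$, $\bot\vdash$, and the following rules (premises / conclusion). Thinning: $\Gamma\vdash\Lambda\,/\,A,\Gamma\vdash\Lambda$; $\Gamma\vdash\,/\,\Gamma\vdash A$. Contraction: $A,A,\Gamma\vdash\Lambda\,/\,A,\Gamma\vdash\Lambda$. Exchange: $\Pi,A,B,\Gamma\vdash\Lambda\,/\,\Pi,B,A,\Gamma\vdash\Lambda$. Cut: $\Gamma\vdash C$ and $C,\Pi\vdash\Lambda\,/\,\Gamma,\Pi\vdash\Lambda$. $\&$: $\Gamma\vdash A$ and $\Gamma\vdash B\,/\,\Gamma\vdash A\&B$; $A,\Gamma\vdash\Lambda\,/\,A\&B,\Gamma\vdash\Lambda$;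 $B,\Gamma\vdash\Lambda\,/\,A\&B,\Gamma\vdash\Lambda$. $\lor$: $A,\Gamma\vdash\Lambda$ and $B,\Gamma\vdash\Lambda\,/\,A\lor B,\Gamma\vdash\Lambda$; $\Gamma\vdash A\,/\,\Gamma\vdash A\lor B$; $\Gamma\vdash B\,/\,\Gamma\vdash A\lor B$. $\neg$: $A,\Gamma\vdash\,/\,\Gamma\vdash\neg A$; $\Gamma\vdash A\,/\,\neg A,\Gamma\vdash$. $\supset$: $A,\Gamma\vdash B\,/\,\Gamma\vdash A\supset B$; $\Gamma\vdash A$ and $B,\Pi\vdash\Lambda\,/\,A\supset B,\Gamma,\Pi\vdash\Lambda$. $\forall$: $\Gamma\vdash F(a)\,/\,\Gamma\vdash\forall x\,F(x)$; $F(a),\Gamma\vdash\Lambda\,/\,\forall x\,F(x),\Gamma\vdash\Lambda$. $\exists$: $\Gamma\vdash F(a)\,/\,\Gamma\vdash\exists x\,F(x)$; $F(a),\Gamma\vdash\Lambda\,/\,\exists x\,F(x),\Gamma\vdash\Lambda$. Here $a$ is a variable and $F(a)$ is the result of (capture-free) substitution of $a$ for $x$ in $F(x)$; in the $\forall$-succedent and $\exists$-antecedent rules $a$ (the eigenvariable) must not occur in the conclusion. $LJ^+$ is $LJ$ extended with the neutralization rule: $N,\Gamma\vdash\Lambda$ and $\neg N,\Gamma\vdash\Lambda\,/\,\Gamma\vdash\Lambda$, where $N$ must be a propositional formula. A formula $A$ is derivable in a calculus if the sequent $\vdash A$ is. *)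

theory Defs
  imports Main
begin

(* Formulas are taken up to renaming of bound variables, using de Bruijn indices.  A variable is
   a natural number; below k quantifiers, the indices 0, ..., k - 1 are bound and the index v + k
   denotes the free variable v.  So "Forall F" is "for all x, F(x)" with x written as index 0
   in F. *)

datatype 'r fm =
    Rel 'r "nat list"
  | Verum
  | Falsum
  | Conj "'r fm" "'r fm"
  | Disj "'r fm" "'r fm"
  | Neg "'r fm"
  | Imp "'r fm" "'r fm"
  | Forall "'r fm"
  | Exists "'r fm"

primrec fv :: "'r fm \<Rightarrow> nat set" where
  "fv (Rel r ts) = set ts"
| "fv Verum = {}"
| "fv Falsum = {}"
| "fv (Conj A B) = fv A \<union> fv B"
| "fv (Disj A B) = fv A \<union> fv B"
| "fv (Neg A) = fv A"
| "fv (Imp A B) = fv A \<union> fv B"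
| "fv (Forall F) = {v. Suc v \<in> fv F}"
| "fv (Exists F) = {v. Suc v \<in> fv F}"

primrec rename :: "(nat \<Rightarrow> nat) \<Rightarrow> 'r fm \<Rightarrow> 'r fm" where
  "rename f (Rel r ts) = Rel r (map f ts)"
| "rename f Verum = Verum"
| "rename f Falsum = Falsum"
| "rename f (Conj A B) = Conj (rename f A) (rename f B)"
| "rename f (Disj A B) = Disj (rename f A) (rename f B)"
| "rename f (Neg A) = Neg (rename f A)"
| "rename f (Imp A B) = Imp (rename f A) (rename f B)"
| "rename f (Forall F) = Forall (rename (case_nat 0 (\<lambda>v. Suc (f v))) F)"
| "rename f (Exists F) = Exists (rename (case_nat 0 (\<lambda>v. Suc (f v))) F)"

(* For F the scope of a quantifier, "inst F a" is F(a): index 0 becomes the variable a, and the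
   remaining free indices are lowered because the quantifier has been removed. *)
definition inst :: "'r fm \<Rightarrow> nat \<Rightarrow> 'r fm" where
  "inst F a = rename (case_nat a (\<lambda>v. v)) F"

(* The signature is given by ar, the arity of each relation symbol: symbols of arity 0 are the
   propositional symbols, the others are the predicate symbols.  The quantifier clauses exclude
   vacuous quantification. *)
primrec formula :: "('r \<Rightarrow> nat) \<Rightarrow> 'r fm \<Rightarrow> bool" where
  "formula ar (Rel r ts) \<longleftrightarrow> length ts = ar r"
| "formula ar Verum \<longleftrightarrow> True"
| "formula ar Falsum \<longleftrightarrow> True"
| "formula ar (Conj A B) \<longleftrightarrow> formula ar A \<and> formula ar B"
| "formula ar (Disj A B) \<longleftrightarrow> formula ar A \<and> formula ar B"
| "formula ar (Neg A) \<longleftrightarrow> formula ar A"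
| "formula ar (Imp A B) \<longleftrightarrow> formula ar A \<and> formula ar B"
| "formula ar (Forall F) \<longleftrightarrow> formula ar F \<and> 0 \<in> fv F"
| "formula ar (Exists F) \<longleftrightarrow> formula ar F \<and> 0 \<in> fv F"

primrec rels :: "'r fm \<Rightarrow> 'r set" where
  "rels (Rel r ts) = {r}"
| "rels Verum = {}"
| "rels Falsum = {}"
| "rels (Conj A B) = rels A \<union> rels B"
| "rels (Disj A B) = rels A \<union> rels B"
| "rels (Neg A) = rels A"
| "rels (Imp A B) = rels A \<union> rels B"
| "rels (Forall F) = rels F"
| "rels (Exists F) = rels F"

definition propositional :: "('r \<Rightarrow> nat) \<Rightarrow> 'r fm \<Rightarrow> bool" where
  "propositional ar A \<longleftrightarrow> formula ar A \<and> (\<forall>r\<in>rels A. ar r = 0)"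

(* "LJ_plus ar G L": the sequent with antecedent G and succedent L (None if empty) is derivable.
   The premises "formula ar _" occur exactly where a rule brings in material not already present
   in its premises; see LJ_plus_formula below. *)
inductive LJ_plus :: "('r \<Rightarrow> nat) \<Rightarrow> 'r fm list \<Rightarrow> 'r fm option \<Rightarrow> bool"
  for ar :: "'r \<Rightarrow> nat" where
  Axiom: "formula ar A \<Longrightarrow> LJ_plus ar [A] (Some A)"
| VerumR: "LJ_plus ar [] (Some Verum)"
| FalsumL: "LJ_plus ar [Falsum] None"
| ThinL: "LJ_plus ar \<Gamma> \<Lambda> \<Longrightarrow> formula ar A \<Longrightarrow> LJ_plus ar (A # \<Gamma>) \<Lambda>"
| ThinR: "LJ_plus ar \<Gamma> None \<Longrightarrow> formula ar A \<Longrightarrow> LJ_plus ar \<Gamma> (Some A)"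
| Contraction: "LJ_plus ar (A # A # \<Gamma>) \<Lambda> \<Longrightarrow> LJ_plus ar (A # \<Gamma>) \<Lambda>"
| Exchange: "LJ_plus ar (\<Pi> @ A # B # \<Gamma>) \<Lambda> \<Longrightarrow> LJ_plus ar (\<Pi> @ B # A # \<Gamma>) \<Lambda>"
| Cut: "LJ_plus ar \<Gamma> (Some C) \<Longrightarrow> LJ_plus ar (C # \<Pi>) \<Lambda> \<Longrightarrow> LJ_plus ar (\<Gamma> @ \<Pi>) \<Lambda>"
| ConjR: "LJ_plus ar \<Gamma> (Some A) \<Longrightarrow> LJ_plus ar \<Gamma> (Some B) \<Longrightarrow> LJ_plus ar \<Gamma> (Some (Conj A B))"
| ConjL1: "LJ_plus ar (A # \<Gamma>) \<Lambda> \<Longrightarrow> formula ar B \<Longrightarrow> LJ_plus ar (Conj A B # \<Gamma>) \<Lambda>"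
| ConjL2: "LJ_plus ar (B # \<Gamma>) \<Lambda> \<Longrightarrow> formula ar A \<Longrightarrow> LJ_plus ar (Conj A B # \<Gamma>) \<Lambda>"
| DisjL: "LJ_plus ar (A # \<Gamma>) \<Lambda> \<Longrightarrow> LJ_plus ar (B # \<Gamma>) \<Lambda> \<Longrightarrow> LJ_plus ar (Disj A B # \<Gamma>) \<Lambda>"
| DisjR1: "LJ_plus ar \<Gamma> (Some A) \<Longrightarrow> formula ar B \<Longrightarrow> LJ_plus ar \<Gamma> (Some (Disj A B))"
| DisjR2: "LJ_plus ar \<Gamma> (Some B) \<Longrightarrow> formula ar A \<Longrightarrow> LJ_plus ar \<Gamma> (Some (Disj A B))"
| NegR: "LJ_plus ar (A # \<Gamma>) None \<Longrightarrow> LJ_plus ar \<Gamma> (Some (Neg A))"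
| NegL: "LJ_plus ar \<Gamma> (Some A) \<Longrightarrow> LJ_plus ar (Neg A # \<Gamma>) None"
| ImpR: "LJ_plus ar (A # \<Gamma>) (Some B) \<Longrightarrow> LJ_plus ar \<Gamma> (Some (Imp A B))"
| ImpL: "LJ_plus ar \<Gamma> (Some A) \<Longrightarrow> LJ_plus ar (B # \<Pi>) \<Lambda> \<Longrightarrow>
    LJ_plus ar (Imp A B # \<Gamma> @ \<Pi>) \<Lambda>"
| ForallR: "LJ_plus ar \<Gamma> (Some (inst F a)) \<Longrightarrow> formula ar (Forall F) \<Longrightarrow>
    \<forall>G \<in> set \<Gamma> \<union> {Forall F}. a \<notin> fv G \<Longrightarrow> LJ_plus ar \<Gamma> (Some (Forall F))"
| ForallL: "LJ_plus ar (inst F a # \<Gamma>) \<Lambda> \<Longrightarrow> formula ar (Forall F) \<Longrightarrow>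
    LJ_plus ar (Forall F # \<Gamma>) \<Lambda>"
| ExistsR: "LJ_plus ar \<Gamma> (Some (inst F a)) \<Longrightarrow> formula ar (Exists F) \<Longrightarrow>
    LJ_plus ar \<Gamma> (Some (Exists F))"
| ExistsL: "LJ_plus ar (inst F a # \<Gamma>) \<Lambda> \<Longrightarrow> formula ar (Exists F) \<Longrightarrow>
    \<forall>G \<in> set \<Gamma> \<union> set_option \<Lambda> \<union> {Exists F}. a \<notin> fv G \<Longrightarrow> LJ_plus ar (Exists F # \<Gamma>) \<Lambda>"
| Neutralization: "LJ_plus ar (N # \<Gamma>) \<Lambda> \<Longrightarrow> LJ_plus ar (Neg N # \<Gamma>) \<Lambda> \<Longrightarrow>
    propositional ar N \<Longrightarrow> LJ_plus ar \<Gamma> \<Lambda>"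

lemma LJ_plus_formula:
  assumes "LJ_plus ar \<Gamma> \<Lambda>"
  shows "\<forall>A \<in> set \<Gamma> \<union> set_option \<Lambda>. formula ar A"
  using assms by induction auto

abbreviation derivable :: "('r \<Rightarrow> nat) \<Rightarrow> 'r fm \<Rightarrow> bool" where
  "derivable ar A \<equiv> LJ_plus ar [] (Some A)"

(* A_1 or (A_2 or (... or A_n)), for n at least 1; the value at [] is a dummy. *)
fun disjunction :: "'r fm list \<Rightarrow> 'r fm" where
  "disjunction [] = Falsum"
| "disjunction [A] = A"
| "disjunction (A # B # As) = Disj A (disjunction (B # As))"

end

theory Submission imports Defs begin

text \<open>
  The neutralization rule only lets a proof assume that certain propositional formulas are
  decided.  A derivation uses it finitely often, so only a finite set \<open>P\<close> of propositional symbols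
  is involved.  Let \<open>T\<close> be a list of formulas that contains \<open>p\<close> or \<open>\<not>p\<close> for every \<open>p\<close> in \<open>P\<close>.
  In the presence of \<open>T\<close> the neutralizations of the derivation become intuitionistic, and the
  existence property of intuitionistic logic survives the addition of literals, which are Harrop
  formulas: for the derivable \<open>\<exists>x A(x)\<close> there is a single variable \<open>t\<close> with \<open>T \<turnstile> A(t)\<close>.
  The variable depends on which literals \<open>T\<close> contains.  There are finitely many choices of literals
  over \<open>P\<close>, and neutralizing the symbols of \<open>P\<close> one after the other joins the choices into the
  disjunction of the corresponding instances.

  The existence property is obtained without cut elimination, by the slash of Kleene and Aczel.  A
  formula is slashed by \<open>T\<close> if it is derivable from \<open>T\<close> and, hereditarily, a disjunction has a
  slashed disjunct and an existential formula a slashed instance.  Cut preserves slashed formulas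
  for trivial reasons, and so does every other rule of \<open>LJ\<close>.  The case of neutralization is
  \<open>slash_decided\<close>: if \<open>T\<close> decides the symbols of \<open>N\<close>, it slashes \<open>N\<close> or \<open>\<not>N\<close>.  The resulting
  theorem is \<open>slash_sound\<close>, and \<open>LJ_plus_disjunction_of_decided\<close> carries out the joining.

  All of this takes place in \<open>LJ_plus\<close> itself: derivability from \<open>T\<close> may use neutralization,
  and this does no harm because the conclusion is again about \<open>LJ_plus\<close>.
\<close>

section \<open>Renaming of variables\<close>

lemma case_nat_comp: "(case_nat a f) \<circ> (case_nat 0 (\<lambda>v. Suc (g v))) = case_nat a (f \<circ> g)"
  by (auto simp: fun_eq_iff split: nat.split)

lemma rename_rename: "rename f (rename g A) = rename (f \<circ> g) A"
  by (induction A arbitrary: f g) (simp_all add: case_nat_comp, simp_all add: comp_def)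

lemma rename_cong: "(\<And>v. v \<in> fv A \<Longrightarrow> f v = g v) \<Longrightarrow> rename f A = rename g A"
proof (induction A arbitrary: f g)
  case (Forall F)
  have "rename (case_nat 0 (\<lambda>v. Suc (f v))) F = rename (case_nat 0 (\<lambda>v. Suc (g v))) F"
    by (rule Forall.IH) (auto simp: Forall.prems split: nat.split)
  then show ?case by simp
next
  case (Exists F)
  have "rename (case_nat 0 (\<lambda>v. Suc (f v))) F = rename (case_nat 0 (\<lambda>v. Suc (g v))) F"
    by (rule Exists.IH) (auto simp: Exists.prems split: nat.split)
  then show ?case by simp
next
  case (Conj A B)
  have "rename f A = rename g A" "rename f B = rename g B"
    using Conj.prems by (auto intro: Conj.IH)
  then show ?case by simp
next
  case (Disj A B)
  have "rename f A = rename g A" "rename f B = rename g B"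
    using Disj.prems by (auto intro: Disj.IH)
  then show ?case by simp
next
  case (Imp A B)
  have "rename f A = rename g A" "rename f B = rename g B"
    using Imp.prems by (auto intro: Imp.IH)
  then show ?case by simp
next
  case (Neg A)
  have "rename f A = rename g A" using Neg.prems by (auto intro: Neg.IH)
  then show ?case by simp
qed simp_all

lemma fv_rename_lift:
  "{v. Suc v \<in> case_nat 0 (\<lambda>v. Suc (f v)) ` S} = f ` {v. Suc v \<in> S}"
proof -
  have "Suc v = case_nat 0 (\<lambda>v. Suc (f v)) w \<longleftrightarrow> (\<exists>u. w = Suc u \<and> v = f u)" for v w
    by (cases w) auto
  then show ?thesis by (auto simp: image_iff)
qed

lemma fv_rename: "fv (rename f A) = f ` fv A"
  by (induction A arbitrary: f) (auto simp: image_Un fv_rename_lift)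

lemma finite_fv: "finite (fv A)"
proof (induction A)
  case (Forall F)
  have "finite (Suc -` fv F)" using Forall by (simp add: finite_vimageI)
  then show ?case by (simp add: vimage_def)
next
  case (Exists F)
  have "finite (Suc -` fv F)" using Exists by (simp add: finite_vimageI)
  then show ?case by (simp add: vimage_def)
qed auto

lemma formula_rename: "formula ar (rename f A) \<longleftrightarrow> formula ar A"
proof -
  have "0 = case_nat 0 (\<lambda>v. Suc (g v)) w \<longleftrightarrow> w = 0" for g w by (cases w) auto
  then have "0 \<in> case_nat 0 (\<lambda>v. Suc (g v)) ` S \<longleftrightarrow> 0 \<in> S" for g S
    by (auto simp: image_iff)
  then show ?thesis by (induction A arbitrary: f) (auto simp: fv_rename)
qed

lemma rels_rename: "rels (rename f A) = rels A"
  by (induction A arbitrary: f) auto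

lemma rename_inst:
  "rename f (inst F a) = inst (rename (case_nat 0 (\<lambda>v. Suc (f v))) F) (f a)"
  unfolding inst_def rename_rename
  by (rule rename_cong) (auto split: nat.split)

text \<open>An eigenvariable can be sent to any variable \<open>b\<close> without changing what \<open>f\<close> does to the rest of
  the sequent.  Quantification over all \<open>f\<close> therefore gives inductions on derivations both a fresh
  choice of the eigenvariable and, for the slash, all its values at once.\<close>
lemma rename_inst_eigenvariable:
  assumes "a \<notin> fv (Forall F)"
  shows "rename (f(a := b)) (inst F a) = inst (rename (case_nat 0 (\<lambda>v. Suc (f v))) F) b"
  unfolding inst_def rename_rename
  by (rule rename_cong) (use assms in \<open>auto split: nat.split\<close>)

lemma fresh_variable: "\<exists>b. \<forall>A\<in>set \<Gamma>. b \<notin> fv A"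
proof -
  have "finite (\<Union>A\<in>set \<Gamma>. fv A)" by (simp add: finite_fv)
  then obtain b where "b \<notin> (\<Union>A\<in>set \<Gamma>. fv A)" using ex_new_if_finite infinite_UNIV_nat by blast
  then show ?thesis by auto
qed

section \<open>Admissible rules\<close>

text \<open>The map \<open>f\<close> may identify variables, so the image of an eigenvariable need not be an
  eigenvariable; the induction hypothesis is used for \<open>f(a := b)\<close> with a fresh \<open>b\<close>.\<close>
lemma LJ_plus_rename:
  "LJ_plus ar \<Gamma> \<Lambda> \<Longrightarrow> LJ_plus ar (map (rename f) \<Gamma>) (map_option (rename f) \<Lambda>)"
proof (induction arbitrary: f rule: LJ_plus.induct)
  case (ForallR \<Gamma> F a)
  let ?F = "rename (case_nat 0 (\<lambda>v. Suc (f v))) F"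
  obtain b where b: "\<forall>G \<in> set (Forall ?F # map (rename f) \<Gamma>). b \<notin> fv G"
    using fresh_variable by blast
  have "map (rename (f(a := b))) \<Gamma> = map (rename f) \<Gamma>"
    using ForallR.hyps by (auto intro!: rename_cong)
  moreover have "rename (f(a := b)) (inst F a) = inst ?F b"
    by (rule rename_inst_eigenvariable) (use ForallR.hyps in simp)
  ultimately have "LJ_plus ar (map (rename f) \<Gamma>) (Some (inst ?F b))"
    using ForallR.IH[of "f(a := b)"] by (simp del: fun_upd_apply map_eq_conv)
  moreover have "formula ar (rename f (Forall F))" using ForallR.hyps by (simp only: formula_rename)
  ultimately show ?case using b by (auto intro!: LJ_plus.ForallR)
next
  case (ExistsL F a \<Gamma> \<Lambda>)
  let ?F = "rename (case_nat 0 (\<lambda>v. Suc (f v))) F"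
  let ?C = "case_option [] (\<lambda>A. [A]) (map_option (rename f) \<Lambda>)"
  obtain b where b: "\<forall>G \<in> set (Exists ?F # map (rename f) \<Gamma> @ ?C). b \<notin> fv G"
    using fresh_variable by blast
  have "map (rename (f(a := b))) \<Gamma> = map (rename f) \<Gamma>"
    "map_option (rename (f(a := b))) \<Lambda> = map_option (rename f) \<Lambda>"
    using ExistsL.hyps by (auto intro!: rename_cong option.map_cong0)
  moreover have "rename (f(a := b)) (inst F a) = inst ?F b"
    by (rule rename_inst_eigenvariable) (use ExistsL.hyps in simp)
  ultimately have "LJ_plus ar (inst ?F b # map (rename f) \<Gamma>) (map_option (rename f) \<Lambda>)"
    using ExistsL.IH[of "f(a := b)"] by (simp del: fun_upd_apply map_eq_conv)
  moreover have "formula ar (rename f (Exists F))" using ExistsL.hyps by (simp only: formula_rename)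
  ultimately show ?case using b by (cases \<Lambda>) (auto intro!: LJ_plus.ExistsL)
next
  case (ForallL F a \<Gamma> \<Lambda>)
  have "formula ar (rename f (Forall F))" using ForallL.hyps by (simp only: formula_rename)
  then show ?case using ForallL.IH[of f] by (auto simp: rename_inst intro: LJ_plus.ForallL)
next
  case (ExistsR \<Gamma> F a)
  have "formula ar (rename f (Exists F))" using ExistsR.hyps by (simp only: formula_rename)
  then show ?case using ExistsR.IH[of f] by (auto simp: rename_inst intro: LJ_plus.ExistsR)
next
  case (Neutralization N \<Gamma> \<Lambda>)
  have "propositional ar (rename f N)"
    using Neutralization.hyps by (simp add: propositional_def formula_rename rels_rename)
  then show ?case using Neutralization.IH[of f] by (auto intro: LJ_plus.Neutralization)
next
  case (Exchange \<Pi> A B \<Gamma> \<Lambda>)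
  then show ?case using LJ_plus.Exchange[of ar "map (rename f) \<Pi>"] by simp
next
  case (Cut \<Gamma> C \<Pi> \<Lambda>)
  then show ?case using LJ_plus.Cut by fastforce
next
  case (ImpL \<Gamma> A B \<Pi> \<Lambda>)
  then show ?case using LJ_plus.ImpL by fastforce
qed (auto intro: LJ_plus.intros simp: formula_rename)

lemma LJ_plus_move: "LJ_plus ar (\<Pi> @ A # \<Sigma> @ \<Gamma>) \<Lambda> \<Longrightarrow> LJ_plus ar (\<Pi> @ \<Sigma> @ A # \<Gamma>) \<Lambda>"
proof (induction \<Sigma> arbitrary: \<Pi>)
  case (Cons B \<Sigma>)
  have "LJ_plus ar ((\<Pi> @ [B]) @ A # \<Sigma> @ \<Gamma>) \<Lambda>"
    using LJ_plus.Exchange[of ar \<Pi> A B "\<Sigma> @ \<Gamma>"] Cons.prems by simp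
  from Cons.IH[OF this] show ?case by simp
qed simp

lemma LJ_plus_swap: "LJ_plus ar (\<Sigma> @ \<Gamma>) \<Lambda> \<Longrightarrow> LJ_plus ar (\<Gamma> @ \<Sigma>) \<Lambda>"
proof (induction \<Sigma> arbitrary: \<Gamma>)
  case (Cons A \<Sigma>)
  have "LJ_plus ar (\<Sigma> @ \<Gamma> @ [A]) \<Lambda>"
    using LJ_plus_move[of ar "[]" A "\<Sigma> @ \<Gamma>" "[]"] Cons.prems by simp
  from Cons.IH[OF this] show ?case by simp
qed simp

lemma LJ_plus_absorb: "LJ_plus ar (\<Gamma> @ \<Delta>) \<Lambda> \<Longrightarrow> set \<Gamma> \<subseteq> set \<Delta> \<Longrightarrow> LJ_plus ar \<Delta> \<Lambda>"
proof (induction \<Gamma>)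
  case (Cons A \<Gamma>)
  then obtain \<Sigma> \<Theta> where \<Delta>: "\<Delta> = \<Sigma> @ A # \<Theta>" by (auto simp: in_set_conv_decomp)
  have "LJ_plus ar ((\<Gamma> @ \<Sigma>) @ A # A # \<Theta>) \<Lambda>"
    using LJ_plus_move[of ar "[]" A "\<Gamma> @ \<Sigma>" "A # \<Theta>"] Cons.prems \<Delta> by simp
  then have "LJ_plus ar (A # A # \<Theta> @ \<Gamma> @ \<Sigma>) \<Lambda>" using LJ_plus_swap by fastforce
  then have "LJ_plus ar ((A # \<Theta>) @ \<Gamma> @ \<Sigma>) \<Lambda>" using LJ_plus.Contraction by fastforce
  then have "LJ_plus ar (\<Gamma> @ \<Delta>) \<Lambda>" using LJ_plus_swap \<Delta> by fastforce
  then show ?case using Cons by simp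
qed simp

lemma LJ_plus_weaken:
  assumes "LJ_plus ar \<Gamma> \<Lambda>" "set \<Gamma> \<subseteq> set \<Delta>" "\<forall>A\<in>set \<Delta>. formula ar A"
  shows "LJ_plus ar \<Delta> \<Lambda>"
proof -
  have "LJ_plus ar (\<Theta> @ \<Gamma>) \<Lambda>" if "\<forall>A\<in>set \<Theta>. formula ar A" for \<Theta>
    using that by (induction \<Theta>) (auto intro: assms(1) LJ_plus.ThinL)
  then have "LJ_plus ar (\<Gamma> @ \<Delta>) \<Lambda>" using assms(3) LJ_plus_swap by blast
  then show ?thesis using LJ_plus_absorb assms(2) by blast
qed

lemma LJ_plus_cuts:
  assumes "LJ_plus ar (\<Gamma> @ \<Delta>) \<Lambda>" "\<forall>C\<in>set \<Gamma>. LJ_plus ar T (Some C)"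
    "set \<Delta> \<subseteq> set T" "\<forall>A\<in>set T. formula ar A"
  shows "LJ_plus ar T \<Lambda>"
  using assms
proof (induction \<Gamma> arbitrary: \<Delta>)
  case Nil
  then show ?case by (auto intro: LJ_plus_weaken)
next
  case (Cons C \<Gamma>)
  have "LJ_plus ar (T @ \<Gamma> @ \<Delta>) \<Lambda>" using Cons.prems by (auto intro: LJ_plus.Cut)
  then have "LJ_plus ar (\<Gamma> @ \<Delta> @ T) \<Lambda>" using LJ_plus_swap by fastforce
  then show ?case using Cons.IH[of "\<Delta> @ T"] Cons.prems by auto
qed

lemma LJ_plus_cut:
  assumes "LJ_plus ar T (Some C)" "LJ_plus ar (C # T) \<Lambda>" "\<forall>A\<in>set T. formula ar A"
  shows "LJ_plus ar T \<Lambda>"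
  using LJ_plus_cuts[of ar "[C]" T \<Lambda> T] assms by auto

lemma LJ_plus_assumption:
  "A \<in> set T \<Longrightarrow> \<forall>A\<in>set T. formula ar A \<Longrightarrow> LJ_plus ar T (Some A)"
  using LJ_plus_weaken[OF LJ_plus.Axiom[of ar A], of T] by auto

lemma LJ_plus_formula_Some: "LJ_plus ar \<Gamma> (Some A) \<Longrightarrow> formula ar A"
  using LJ_plus_formula by fastforce

lemma LJ_plus_contradiction:
  assumes "LJ_plus ar T (Some (Neg A))" "LJ_plus ar T (Some A)" "\<forall>A\<in>set T. formula ar A"
  shows "LJ_plus ar T None"
  using LJ_plus_cut LJ_plus.NegL assms by blast

section \<open>The slash\<close>

text \<open>This is the slash \<open>T | rename f A\<close>.  The renaming is kept as an environment because the instances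
  of a quantified formula are not its subformulas; in this form the recursion is structural.
  Derivability from \<open>T\<close> is a conjunct throughout (the variant of Aczel).  With it the customary
  clause for negation, that a slashed \<open>A\<close> makes \<open>T\<close> inconsistent, follows from the derivability of
  \<open>\<not>A\<close>, which is why negations are treated like atoms.\<close>
primrec slash :: "('r \<Rightarrow> nat) \<Rightarrow> 'r fm list \<Rightarrow> (nat \<Rightarrow> nat) \<Rightarrow> 'r fm \<Rightarrow> bool" where
  "slash ar T f (Rel r ts) \<longleftrightarrow> LJ_plus ar T (Some (rename f (Rel r ts)))"
| "slash ar T f Verum \<longleftrightarrow> LJ_plus ar T (Some Verum)"
| "slash ar T f Falsum \<longleftrightarrow> LJ_plus ar T (Some Falsum)"
| "slash ar T f (Conj A B) \<longleftrightarrow> LJ_plus ar T (Some (rename f (Conj A B))) \<and>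
     slash ar T f A \<and> slash ar T f B"
| "slash ar T f (Disj A B) \<longleftrightarrow> LJ_plus ar T (Some (rename f (Disj A B))) \<and>
     (slash ar T f A \<or> slash ar T f B)"
| "slash ar T f (Neg A) \<longleftrightarrow> LJ_plus ar T (Some (rename f (Neg A)))"
| "slash ar T f (Imp A B) \<longleftrightarrow> LJ_plus ar T (Some (rename f (Imp A B))) \<and>
     (slash ar T f A \<longrightarrow> slash ar T f B)"
| "slash ar T f (Forall F) \<longleftrightarrow> LJ_plus ar T (Some (rename f (Forall F))) \<and>
     (\<forall>a. slash ar T (case_nat a f) F)"
| "slash ar T f (Exists F) \<longleftrightarrow> LJ_plus ar T (Some (rename f (Exists F))) \<and>
     (\<exists>a. slash ar T (case_nat a f) F)"

lemma slash_derivable: "slash ar T f A \<Longrightarrow> LJ_plus ar T (Some (rename f A))"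
  by (cases A) auto

lemma slash_rename: "slash ar T f (rename g A) \<longleftrightarrow> slash ar T (f \<circ> g) A"
proof (induction A arbitrary: f g)
  case (Forall F)
  show ?case
    using rename_rename[of f g "Forall F"] by (simp add: Forall.IH case_nat_comp, simp add: comp_def)
next
  case (Exists F)
  show ?case
    using rename_rename[of f g "Exists F"] by (simp add: Exists.IH case_nat_comp, simp add: comp_def)
qed (simp_all add: rename_rename)

lemma slash_cong: "(\<And>v. v \<in> fv A \<Longrightarrow> f v = g v) \<Longrightarrow> slash ar T f A \<longleftrightarrow> slash ar T g A"
proof (induction A arbitrary: f g)
  case (Forall F)
  have "slash ar T (case_nat a f) F = slash ar T (case_nat a g) F" for a
    by (rule Forall.IH) (auto simp: Forall.prems split: nat.split)
  then show ?case using rename_cong[of "Forall F" f g, OF Forall.prems] by simp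
next
  case (Exists F)
  have "slash ar T (case_nat a f) F = slash ar T (case_nat a g) F" for a
    by (rule Exists.IH) (auto simp: Exists.prems split: nat.split)
  then show ?case using rename_cong[of "Exists F" f g, OF Exists.prems] by simp
next
  case (Rel r ts) 
  have "map f ts = map g ts" using Rel.prems by simp
  then show ?case by (simp del: map_eq_conv)
next
  case (Conj A B) 
  have "slash ar T f A = slash ar T g A" "slash ar T f B = slash ar T g B"
    using Conj.prems by (auto intro!: Conj.IH)
  then show ?case using rename_cong[of "Conj A B" f g, OF Conj.prems] by simp
next
  case (Disj A B) 
  have "slash ar T f A = slash ar T g A" "slash ar T f B = slash ar T g B"
    using Disj.prems by (auto intro!: Disj.IH)
  then show ?case using rename_cong[of "Disj A B" f g, OF Disj.prems] by simp
next
  case (Imp A B) 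
  have "slash ar T f A = slash ar T g A" "slash ar T f B = slash ar T g B"
    using Imp.prems by (auto intro!: Imp.IH)
  then show ?case using rename_cong[of "Imp A B" f g, OF Imp.prems] by simp
next
  case (Neg A)
  show ?case using rename_cong[of "Neg A" f g, OF Neg.prems] by simp
qed simp_all

lemma slash_inst: "slash ar T f (inst F a) \<longleftrightarrow> slash ar T (case_nat (f a) f) F"
  unfolding inst_def slash_rename by (rule slash_cong) (auto split: nat.split)

lemma slash_inst_eigenvariable:
  assumes "a \<notin> fv (Forall F)"
  shows "slash ar T (f(a := b)) (inst F a) \<longleftrightarrow> slash ar T (case_nat b f) F"
  unfolding inst_def slash_rename
  by (rule slash_cong) (use assms in \<open>auto split: nat.split\<close>)

text \<open>If \<open>T\<close> contains both \<open>p\<close> and \<open>\<not>p\<close>, or is inconsistent for another reason, the slash becomes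
  trivial.  Hence thinning in the succedent is sound for every \<open>T\<close>.\<close>
lemma slash_inconsistent:
  assumes "LJ_plus ar T None" "formula ar A"
  shows "slash ar T f A"
proof -
  have *: "LJ_plus ar T (Some (rename f A))" if "formula ar A" for f A
    using assms(1) that by (auto intro: LJ_plus.ThinR simp: formula_rename)
  show ?thesis using assms(2)
  proof (induction A arbitrary: f)
    case (Forall F) then show ?case using *[OF Forall.prems] by simp
  next
    case (Exists F) then show ?case using *[OF Exists.prems] by simp
  next
    case (Conj A B) then show ?case using *[OF Conj.prems] by simp
  next
    case (Disj A B) then show ?case using *[OF Disj.prems] by simp
  next
    case (Imp A B) then show ?case using *[OF Imp.prems] by simp
  next
    case (Neg A) then show ?case using *[OF Neg.prems] by simp
  next
    case (Rel r ts) then show ?case using *[OF Rel.prems] by simp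
  qed (use *[of Verum] *[of Falsum] in simp_all)
qed

section \<open>Deciding propositional formulas\<close>

definition decides :: "('r \<Rightarrow> nat) \<Rightarrow> 'r set \<Rightarrow> 'r fm list \<Rightarrow> bool" where
  "decides ar P T \<longleftrightarrow> (\<forall>C\<in>set T. formula ar C) \<and>
     (\<forall>r\<in>P. ar r = 0 \<longrightarrow> Rel r [] \<in> set T \<or> Neg (Rel r []) \<in> set T)"

text \<open>In a propositional formula all relation symbols have an empty list of arguments.  As vacuous
  quantification is excluded, such a formula contains no quantifiers.\<close>
lemma fv_propositional: "propositional ar A \<Longrightarrow> fv A = {}"
  by (induction A) (auto simp: propositional_def)

text \<open>Truth tables are evaluated inside \<open>T\<close>.  The slash enters at disjunction, where it is needed that
  one of the disjuncts is itself slashed: when neither is, \<open>T\<close> refutes both and so refutes the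
  disjunction.\<close>
lemma slash_decided:
  assumes "propositional ar N" "rels N \<subseteq> P" "decides ar P T"
  shows "slash ar T f N \<or> slash ar T f (Neg N)"
proof -
  have T: "\<forall>C\<in>set T. formula ar C" using assms(3) by (simp add: decides_def)
  have neg: "LJ_plus ar T (Some (Neg A))" if "LJ_plus ar (A # T) None" for A
    using that by (rule LJ_plus.NegR)
  have refuted: "LJ_plus ar (A # T) None" if "LJ_plus ar T (Some (Neg A))" for A
  proof -
    have A: "formula ar A" using LJ_plus_formula_Some[OF that] by simp
    then have "LJ_plus ar (A # T) (Some A)" using LJ_plus_assumption[of A "A # T"] T by simp
    moreover have "LJ_plus ar (A # T) (Some (Neg A))" using that A by (rule LJ_plus.ThinL)
    ultimately show ?thesis using LJ_plus_contradiction A T by (metis set_ConsD)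
  qed
  show ?thesis using assms(1,2)
  proof (induction N)
    case (Rel r ts)
    then have "ts = []" "ar r = 0" "r \<in> P" by (auto simp: propositional_def)
    then show ?case using LJ_plus_assumption[OF _ T] assms(3) by (auto simp: decides_def)
  next
    case Verum
    then show ?case using LJ_plus_weaken[OF LJ_plus.VerumR, of T ar] T by simp
  next
    case Falsum
    then show ?case using LJ_plus_weaken[OF LJ_plus.FalsumL, of "Falsum # T"] T neg by simp
  next
    case (Conj A B)
    then have fm: "formula ar (rename f A)" "formula ar (rename f B)"
      by (auto simp: propositional_def formula_rename)
    consider "slash ar T f A" "slash ar T f B" | "slash ar T f (Neg A)" | "slash ar T f (Neg B)"
      using Conj by (auto simp: propositional_def)
    then show ?case
    proof cases
      case 1
      then show ?thesis using LJ_plus.ConjR[OF slash_derivable slash_derivable] by auto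
    next
      case 2
      then show ?thesis using neg[OF LJ_plus.ConjL1[OF refuted fm(2)]] by simp
    next
      case 3
      then show ?thesis using neg[OF LJ_plus.ConjL2[OF refuted fm(1)]] by simp
    qed
  next
    case (Disj A B)
    then have fm: "formula ar (rename f A)" "formula ar (rename f B)"
      by (auto simp: propositional_def formula_rename)
    consider "slash ar T f A" | "slash ar T f B" | "slash ar T f (Neg A)" "slash ar T f (Neg B)"
      using Disj by (auto simp: propositional_def)
    then show ?case
    proof cases
      case 1
      then show ?thesis using LJ_plus.DisjR1[OF slash_derivable fm(2)] by simp
    next
      case 2
      then show ?thesis using LJ_plus.DisjR2[OF slash_derivable fm(1)] by simp
    next
      case 3
      then show ?thesis using neg[OF LJ_plus.DisjL[OF refuted refuted]] by simp
    qed
  next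
    case (Neg A)
    then consider "slash ar T f A" | "slash ar T f (Neg A)" by (auto simp: propositional_def)
    then show ?case
    proof cases
      case 1
      then show ?thesis using neg[OF LJ_plus.NegL[OF slash_derivable]] by simp
    qed auto
  next
    case (Imp A B)
    then have fm: "formula ar (rename f A)" "formula ar (rename f B)" "formula ar B"
      by (auto simp: propositional_def formula_rename)
    consider "slash ar T f B" | "slash ar T f (Neg A)" | "slash ar T f A" "slash ar T f (Neg B)"
      using Imp by (auto simp: propositional_def)
    then show ?case
    proof cases
      case 1
      then show ?thesis using LJ_plus.ImpR[OF LJ_plus.ThinL[OF slash_derivable fm(1)]] by simp
    next
      \<comment> \<open>\<open>T\<close> refutes \<open>A\<close>; if it also slashes \<open>A\<close>, it is inconsistent and slashes \<open>B\<close>.\<close>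
      case 2
      then have "LJ_plus ar T (Some (Imp (rename f A) (rename f B)))"
        using LJ_plus.ImpR[OF LJ_plus.ThinR[OF refuted fm(2)]] by simp
      moreover have "slash ar T f B" if "slash ar T f A"
        using slash_inconsistent LJ_plus_contradiction slash_derivable that 2 T fm(3) by fastforce
      ultimately show ?thesis by simp
    next
      case 3
      have "LJ_plus ar (Imp (rename f A) (rename f B) # T @ T) None"
        using LJ_plus.ImpL[OF slash_derivable refuted] 3 by simp
      then have "LJ_plus ar (Imp (rename f A) (rename f B) # T) None"
        using LJ_plus_weaken[of ar _ None "Imp (rename f A) (rename f B) # T"] T fm by auto
      then show ?thesis using neg by simp
    qed
  next
    case (Forall F)
    then have "0 \<in> fv F" "propositional ar F" by (auto simp: propositional_def)
    then show ?case using fv_propositional by blast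
  next
    case (Exists F)
    then have "0 \<in> fv F" "propositional ar F" by (auto simp: propositional_def)
    then show ?case using fv_propositional by blast
  qed
qed

section \<open>Soundness of the slash\<close>

definition slash_seq ::
    "('r \<Rightarrow> nat) \<Rightarrow> 'r fm list \<Rightarrow> 'r fm list \<Rightarrow> 'r fm option \<Rightarrow> bool" where
  "slash_seq ar T \<Gamma> \<Lambda> \<longleftrightarrow> (\<forall>f. (\<forall>C\<in>set \<Gamma>. slash ar T f C) \<longrightarrow>
     (case \<Lambda> of None \<Rightarrow> LJ_plus ar T None | Some A \<Rightarrow> slash ar T f A))"

text \<open>This settles the derivability conjunct of the slash, for all rules at once.\<close>
lemma slash_entails:
  assumes "LJ_plus ar \<Gamma> \<Lambda>" "\<forall>C\<in>set \<Gamma>. slash ar T f C" "\<forall>C\<in>set T. formula ar C"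
  shows "LJ_plus ar T (map_option (rename f) \<Lambda>)"
  using LJ_plus_cuts[of ar "map (rename f) \<Gamma>" "[]"] LJ_plus_rename[OF assms(1)] assms
  by (auto simp: slash_derivable)

text \<open>The filter stands for ``for every sufficiently large finite set of symbols''.  It takes care of
  the bookkeeping in rules with two premises, and only neutralization adds a demand on \<open>P\<close>, namely
  that it contain the symbols of \<open>N\<close>.\<close>
lemma slash_sound:
  assumes "LJ_plus ar \<Gamma> \<Lambda>"
  shows "\<forall>\<^sub>F P in finite_subsets_at_top UNIV. \<forall>T. decides ar P T \<longrightarrow> slash_seq ar T \<Gamma> \<Lambda>"
  using assms
proof (induction rule: LJ_plus.induct)
  case (Axiom A)
  show ?case by (simp add: slash_seq_def)
next
  case VerumR
  show ?case
    using slash_entails[OF LJ_plus.VerumR]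
    by (intro always_eventually) (auto simp: slash_seq_def decides_def)
next
  case FalsumL
  show ?case
    using slash_entails[OF LJ_plus.FalsumL]
    by (intro always_eventually) (auto simp: slash_seq_def decides_def)
next
  case (ThinL \<Gamma> \<Lambda> A)
  from ThinL.IH show ?case by eventually_elim (simp add: slash_seq_def)
next
  case (ThinR \<Gamma> A)
  from ThinR.IH show ?case
    by eventually_elim (use ThinR.hyps in \<open>auto simp: slash_seq_def intro: slash_inconsistent\<close>)
next
  case (Contraction A \<Gamma> \<Lambda>)
  from Contraction.IH show ?case by eventually_elim (simp add: slash_seq_def)
next
  case (Exchange \<Pi> A B \<Gamma> \<Lambda>)
  from Exchange.IH show ?case by eventually_elim (simp add: slash_seq_def)
next
  case (Cut \<Gamma> C \<Pi> \<Lambda>)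
  from Cut.IH show ?case by eventually_elim (auto simp: slash_seq_def)
next
  case (ConjR \<Gamma> A B)
  note d = slash_entails[OF LJ_plus.ConjR[OF ConjR.hyps]]
  from ConjR.IH show ?case
    by eventually_elim (use d in \<open>auto simp: slash_seq_def decides_def\<close>)
next
  case (ConjL1 A \<Gamma> \<Lambda> B)
  from ConjL1.IH show ?case by eventually_elim (simp add: slash_seq_def)
next
  case (ConjL2 B \<Gamma> \<Lambda> A)
  from ConjL2.IH show ?case by eventually_elim (simp add: slash_seq_def)
next
  case (DisjL A \<Gamma> \<Lambda> B)
  from DisjL.IH show ?case by eventually_elim (auto simp: slash_seq_def)
next
  case (DisjR1 \<Gamma> A B)
  note d = slash_entails[OF LJ_plus.DisjR1[OF DisjR1.hyps]]
  from DisjR1.IH show ?case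
    by eventually_elim (use d in \<open>auto simp: slash_seq_def decides_def\<close>)
next
  case (DisjR2 \<Gamma> B A)
  note d = slash_entails[OF LJ_plus.DisjR2[OF DisjR2.hyps]]
  from DisjR2.IH show ?case
    by eventually_elim (use d in \<open>auto simp: slash_seq_def decides_def\<close>)
next
  case (NegR A \<Gamma>)
  show ?case
    using slash_entails[OF LJ_plus.NegR[OF NegR.hyps]]
    by (intro always_eventually) (auto simp: slash_seq_def decides_def)
next
  case (NegL \<Gamma> A)
  have "slash_seq ar T (Neg A # \<Gamma>) None" if "decides ar P T" for P T
    using slash_entails[OF LJ_plus.NegL[OF NegL.hyps], of T] that
    by (auto simp: slash_seq_def decides_def simp del: slash.simps)
  then show ?case by simp
next
  case (ImpR A \<Gamma> B)
  note d = slash_entails[OF LJ_plus.ImpR[OF ImpR.hyps]]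
  from ImpR.IH show ?case
    by eventually_elim (use d in \<open>auto simp: slash_seq_def decides_def\<close>)
next
  case (ImpL \<Gamma> A B \<Pi> \<Lambda>)
  from ImpL.IH show ?case by eventually_elim (auto simp: slash_seq_def)
next
  case (ForallR \<Gamma> F a)
  note d = slash_entails[OF LJ_plus.ForallR[OF ForallR.hyps]]
  from ForallR.IH show ?case
  proof (eventually_elim, intro allI impI)
    fix P T
    assume IH: "\<forall>T. decides ar P T \<longrightarrow> slash_seq ar T \<Gamma> (Some (inst F a))" and T: "decides ar P T"
    show "slash_seq ar T \<Gamma> (Some (Forall F))"
      unfolding slash_seq_def
    proof (intro allI impI)
      fix f
      assume \<Gamma>: "\<forall>C\<in>set \<Gamma>. slash ar T f C"
      \<comment> \<open>The eigenvariable takes the value \<open>b\<close>; the antecedent does not notice the change.\<close>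
      have "slash ar T (case_nat b f) F" for b
      proof -
        have "\<forall>C\<in>set \<Gamma>. slash ar T (f(a := b)) C"
          using \<Gamma> ForallR.hyps(3) slash_cong[of _ f "f(a := b)"] by fastforce
        then have "slash ar T (f(a := b)) (inst F a)" using IH T by (auto simp: slash_seq_def)
        then show ?thesis using slash_inst_eigenvariable ForallR.hyps(3) by blast
      qed
      then show "case Some (Forall F) of None \<Rightarrow> LJ_plus ar T None | Some A \<Rightarrow> slash ar T f A"
        using d[OF \<Gamma>] T by (simp add: decides_def)
    qed
  qed
next
  case (ForallL F a \<Gamma> \<Lambda>)
  from ForallL.IH show ?case by eventually_elim (simp add: slash_seq_def slash_inst)
next
  case (ExistsR \<Gamma> F a)
  note d = slash_entails[OF LJ_plus.ExistsR[OF ExistsR.hyps]]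
  from ExistsR.IH show ?case
    by eventually_elim (use d in \<open>auto simp: slash_seq_def decides_def slash_inst\<close>)
next
  case (ExistsL F a \<Gamma> \<Lambda>)
  from ExistsL.IH show ?case
  proof (eventually_elim, intro allI impI)
    fix P T
    assume IH: "\<forall>T. decides ar P T \<longrightarrow> slash_seq ar T (inst F a # \<Gamma>) \<Lambda>" and T: "decides ar P T"
    show "slash_seq ar T (Exists F # \<Gamma>) \<Lambda>"
      unfolding slash_seq_def
    proof (intro allI impI)
      fix f
      assume ant: "\<forall>C\<in>set (Exists F # \<Gamma>). slash ar T f C"
      then obtain b where "slash ar T (case_nat b f) F" by auto
      then have "slash ar T (f(a := b)) (inst F a)"
        using slash_inst_eigenvariable[of a F] ExistsL.hyps(3) by simp
      moreover have "\<forall>C\<in>set \<Gamma>. slash ar T (f(a := b)) C"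
        using ant ExistsL.hyps(3) slash_cong[of _ f "f(a := b)"] by fastforce
      ultimately have "case \<Lambda> of None \<Rightarrow> LJ_plus ar T None | Some A \<Rightarrow> slash ar T (f(a := b)) A"
        using IH T by (auto simp: slash_seq_def)
      moreover have "slash ar T (f(a := b)) A = slash ar T f A" if "\<Lambda> = Some A" for A
        by (rule slash_cong) (use that ExistsL.hyps(3) in auto)
      ultimately show "case \<Lambda> of None \<Rightarrow> LJ_plus ar T None | Some A \<Rightarrow> slash ar T f A"
        by (simp split: option.splits)
    qed
  qed
next
  case (Neutralization N \<Gamma> \<Lambda>)
  have "finite (rels N)" by (induction N) auto
  then have "\<forall>\<^sub>F P in finite_subsets_at_top UNIV. rels N \<subseteq> P"
    by (auto simp: eventually_finite_subsets_at_top)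
  with Neutralization.IH show ?case
  proof (eventually_elim, intro allI impI)
    fix P T
    assume IH: "\<forall>T. decides ar P T \<longrightarrow> slash_seq ar T (N # \<Gamma>) \<Lambda>"
      "\<forall>T. decides ar P T \<longrightarrow> slash_seq ar T (Neg N # \<Gamma>) \<Lambda>"
      and P: "rels N \<subseteq> P" and T: "decides ar P T"
    have "slash ar T f N \<or> slash ar T f (Neg N)" for f
      using Neutralization.hyps(3) P T by (rule slash_decided)
    then show "slash_seq ar T \<Gamma> \<Lambda>"
      using IH T by (simp add: slash_seq_def del: slash.simps) blast
  qed
qed

section \<open>Joining the cases\<close>

lemma LJ_plus_disjunctionR:
  assumes "A \<in> set As" "\<forall>B\<in>set As. formula ar B" "LJ_plus ar \<Gamma> (Some A)"
  shows "LJ_plus ar \<Gamma> (Some (disjunction As))"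
  using assms
proof (induction As rule: disjunction.induct)
  case (3 B C As)
  have "formula ar (disjunction (C # As))"
    using 3(3) by (induction "C # As" arbitrary: C As rule: disjunction.induct) auto
  with 3 show ?case by (auto intro: LJ_plus.DisjR1 LJ_plus.DisjR2)
qed auto

lemma LJ_plus_disjunctionL:
  assumes "As \<noteq> []" "\<And>A. A \<in> set As \<Longrightarrow> LJ_plus ar (A # \<Gamma>) \<Lambda>"
  shows "LJ_plus ar (disjunction As # \<Gamma>) \<Lambda>"
  using assms by (induction As rule: disjunction.induct) (auto intro: LJ_plus.DisjL)

lemma LJ_plus_disjunction_mono:
  assumes "LJ_plus ar \<Gamma> (Some (disjunction As))" "As \<noteq> []" "set As \<subseteq> set Bs"
    "\<forall>B\<in>set Bs. formula ar B" "\<forall>C\<in>set \<Gamma>. formula ar C"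
  shows "LJ_plus ar \<Gamma> (Some (disjunction Bs))"
proof -
  have "LJ_plus ar (A # \<Gamma>) (Some (disjunction Bs))" if "A \<in> set As" for A
    using that assms by (intro LJ_plus_disjunctionR[of A] LJ_plus_assumption) auto
  then have "LJ_plus ar (disjunction As # \<Gamma>) (Some (disjunction Bs))"
    using LJ_plus_disjunctionL assms(2) by blast
  then show ?thesis using LJ_plus_cut assms(1,5) by blast
qed

text \<open>By induction on \<open>P\<close>, branching over \<open>p\<close> and \<open>\<not>p\<close> for each propositional symbol \<open>p\<close>.  The
  two branches yield different lists of witnesses; both disjunctions imply the one over the
  concatenated list, to which neutralization of \<open>p\<close> applies.\<close>
lemma LJ_plus_disjunction_of_decided:
  assumes "finite P" "formula ar A" "\<forall>C\<in>set \<Gamma>. formula ar C"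
    "\<And>T. set \<Gamma> \<subseteq> set T \<Longrightarrow> decides ar P T \<Longrightarrow> \<exists>t. LJ_plus ar T (Some (inst A t))"
  shows "\<exists>ts. ts \<noteq> [] \<and> LJ_plus ar \<Gamma> (Some (disjunction (map (inst A) ts)))"
  using assms(1,3,4)
proof (induction P arbitrary: \<Gamma> rule: finite_induct)
  case empty
  then obtain t where "LJ_plus ar \<Gamma> (Some (inst A t))" by (force simp: decides_def)
  then show ?case by (intro exI[of _ "[t]"]) simp
next
  case (insert r P)
  show ?case
  proof (cases "ar r = 0")
    case False
    then have "decides ar (insert r P) T = decides ar P T" for T by (auto simp: decides_def)
    then show ?thesis using insert.IH insert.prems by simp
  next
    case True
    have fm: "formula ar (inst A t)" for t
      using assms(2) by (simp add: inst_def formula_rename)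
    let ?p = "Rel r []"
    have "\<exists>ts. ts \<noteq> [] \<and> LJ_plus ar (L # \<Gamma>) (Some (disjunction (map (inst A) ts)))"
      if "L = ?p \<or> L = Neg ?p" for L
    proof (rule insert.IH)
      show "\<forall>C\<in>set (L # \<Gamma>). formula ar C" using insert.prems(1) that True by auto
      show "\<exists>t. LJ_plus ar T (Some (inst A t))" if "set (L # \<Gamma>) \<subseteq> set T" "decides ar P T" for T
        using insert.prems(2)[of T] that \<open>L = ?p \<or> L = Neg ?p\<close> by (auto simp: decides_def)
    qed
    then obtain ts us where
      ts: "ts \<noteq> []" "LJ_plus ar (?p # \<Gamma>) (Some (disjunction (map (inst A) ts)))" and
      us: "us \<noteq> []" "LJ_plus ar (Neg ?p # \<Gamma>) (Some (disjunction (map (inst A) us)))"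
      by metis
    let ?D = "disjunction (map (inst A) (ts @ us))"
    have "LJ_plus ar (?p # \<Gamma>) (Some ?D)"
      by (rule LJ_plus_disjunction_mono[OF ts(2)]) (use ts(1) fm True insert.prems(1) in auto)
    moreover have "LJ_plus ar (Neg ?p # \<Gamma>) (Some ?D)"
      by (rule LJ_plus_disjunction_mono[OF us(2)]) (use us(1) fm True insert.prems(1) in auto)
    moreover have "propositional ar ?p" using True by (simp add: propositional_def)
    ultimately have "LJ_plus ar \<Gamma> (Some ?D)" by (rule LJ_plus.Neutralization)
    then show ?thesis using ts(1) by (intro exI[of _ "ts @ us"]) simp
  qed
qed

theorem mainTheorem17:
  fixes ar :: "'r \<Rightarrow> nat" and A :: "'r fm"
  assumes "derivable ar (Exists A)"
  shows "\<exists>ts :: nat list. ts \<noteq> [] \<and> derivable ar (disjunction (map (inst A) ts))"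
proof -
  obtain P where "finite P" and
    P: "\<And>T. decides ar P T \<Longrightarrow> slash_seq ar T [] (Some (Exists A))"
    using slash_sound[OF assms] by (auto simp: eventually_finite_subsets_at_top)
  have "\<exists>t. LJ_plus ar T (Some (inst A t))" if T: "decides ar P T" for T
  proof -
    have "slash ar T (\<lambda>v. v) (Exists A)" using P[OF T] by (simp add: slash_seq_def)
    then obtain t where "slash ar T (case_nat t (\<lambda>v. v)) A" by auto
    then have "LJ_plus ar T (Some (inst A t))" unfolding inst_def by (rule slash_derivable)
    then show ?thesis ..
  qed
  moreover have "formula ar A" using LJ_plus_formula_Some[OF assms] by simp
  ultimately show ?thesis using LJ_plus_disjunction_of_decided[OF \<open>finite P\<close>, of ar A "[]"] by simp
qed

end
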